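(* If $V$ is an object of the category $\mathcal{A}_2$ (defined in the context), then there exist a left quasigroup $(G,* )$ satisfying $$(a*c)\backslash_G((a*b)*c)=(a'*c)\backslash_G((a'*b)*c)\quad(\forall a,a',b,c\in G)$$ and a bijection $\pi':L_V\to G$ such that $V=[(L_V,(G,\mu^G_2),\pi')]$, where $\mu^G_2(a,b,c)=c*(b\backslash_G a)$ $(a,b,c\in G)$.
   Context: A left quasigroup $(L,\cdot)$ is a nonempty set $L$ with a binary operation such that for all $u,w\in L$ there is a unique $v\in L$ with $u\cdot v=w$; this $v$ is denoted $u\backslash_L w$ (similarly $\backslash_G$ for $(G,* )$). A ternary system $(M,\mu)$ is a nonempty set $M$ with a map $\mu:M^3\to M$; a homomorphism $h:(M,\mu)\to(M',\mu')$ is a map with $h(\mu(a,b,c))=\mu'(h(a),h(b),h(c))$ for all $a,b,c$. Let $LMB$ be the collection of all triplets $(L,M,\pi)$ where $L$ is a left quasigroup, $M=(M,\mu)$ is a ternary system satisfying, for all $a,b,c,d\in M$, $$\mu(a,\mu(a,b,c),\mu(\mu(a,b,c),c,d))=\mu(a,b,\mu(b,c,d)),$$ $$\mu(\mu(a,b,c),c,d)=\mu(\mu(a,b,\mu(b,c,d)),\mu(b,c,d),d),$$ and $\pi:L\to M$ is a bijection. Write $(L,M,\pi)\sim(L',M',\pi')$ iff $L=L'$ as left quasigroups and $\pi'\pi^{-1}:M\to M'$ is a homomorphism of ternary systems (an equivalence relation). Objects of the category $\mathcal{A}$ are the equivalence classes $[(L,M,\pi)]$; $L_V$ denotes the common left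 quasigroup of all representatives of $V$. $V$ is an object of $\mathcal{A}_2$ iff it is an object of $\mathcal{A}$ having a representative $(L,(M,\mu),\pi)$ such that $\mu(\mu(a,b,c),c,d)=\mu(a,b,d)$ and $\mu(a,b,b)=a$ for all $a,b,c,d\in M$. *)

theory Defs
  imports "HOL-Library.FuncSet"
begin

text \<open>
  Structures are a carrier set together with an operation lying in the extensional function
  space over that carrier, so that equality in the logic is equality of structures. Likewise the
  bijections are kept extensional. The class of all triplets is rendered as the set of triplets
  whose carriers are subsets of two arbitrary types \<open>'l\<close> and \<open>'m\<close>; left quasigroups and ternary
  systems need not exhaust these types.
\<close>

record 'a binary_system =
  bcarrier :: "'a set"
  bop :: "'a \<times> 'a \<Rightarrow> 'a"

record 'a ternary_system =
  tcarrier :: "'a set"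
  top3 :: "'a \<times> 'a \<times> 'a \<Rightarrow> 'a"

definition left_quasigroup :: "'a binary_system \<Rightarrow> bool" where
  "left_quasigroup L \<longleftrightarrow>
     bcarrier L \<noteq> {} \<and>
     bop L \<in> bcarrier L \<times> bcarrier L \<rightarrow>\<^sub>E bcarrier L \<and>
     (\<forall>u\<in>bcarrier L. \<forall>w\<in>bcarrier L. \<exists>!v. v \<in> bcarrier L \<and> bop L (u, v) = w)"

definition ldiv :: "'a binary_system \<Rightarrow> 'a \<Rightarrow> 'a \<Rightarrow> 'a" where
  "ldiv L u w = (THE v. v \<in> bcarrier L \<and> bop L (u, v) = w)"

definition is_ternary_system :: "'a ternary_system \<Rightarrow> bool" where
  "is_ternary_system M \<longleftrightarrow>
     tcarrier M \<noteq> {} \<and>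
     top3 M \<in> tcarrier M \<times> tcarrier M \<times> tcarrier M \<rightarrow>\<^sub>E tcarrier M"

definition ternary_hom ::
    "'a ternary_system \<Rightarrow> 'b ternary_system \<Rightarrow> ('a \<Rightarrow> 'b) \<Rightarrow> bool" where
  "ternary_hom M M' h \<longleftrightarrow>
     h \<in> tcarrier M \<rightarrow> tcarrier M' \<and>
     (\<forall>a\<in>tcarrier M. \<forall>b\<in>tcarrier M. \<forall>c\<in>tcarrier M.
        h (top3 M (a, b, c)) = top3 M' (h a, h b, h c))"

type_synonym ('l, 'm) triplet =
  "'l binary_system \<times> 'm ternary_system \<times> ('l \<Rightarrow> 'm)"

definition LMB :: "('l, 'm) triplet set" where
  "LMB = {(L, M, \<pi>).
     left_quasigroup L \<and> is_ternary_system M \<and>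
     (let \<mu> = (\<lambda>a b c. top3 M (a, b, c)) in
       \<forall>a\<in>tcarrier M. \<forall>b\<in>tcarrier M. \<forall>c\<in>tcarrier M. \<forall>d\<in>tcarrier M.
         \<mu> a (\<mu> a b c) (\<mu> (\<mu> a b c) c d) = \<mu> a b (\<mu> b c d) \<and>
         \<mu> (\<mu> a b c) c d = \<mu> (\<mu> a b (\<mu> b c d)) (\<mu> b c d) d) \<and>
     \<pi> \<in> extensional (bcarrier L) \<and> bij_betw \<pi> (bcarrier L) (tcarrier M)}"

definition LMB_rel :: "(('l, 'm) triplet \<times> ('l, 'm) triplet) set" where
  "LMB_rel = {((L, M, \<pi>), (L', M', \<pi>')).
     (L, M, \<pi>) \<in> LMB \<and> (L', M', \<pi>') \<in> LMB \<and>
     L = L' \<and> ternary_hom M M' (\<pi>' \<circ> inv_into (bcarrier L) \<pi>)}"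

definition LMB_class :: "('l, 'm) triplet \<Rightarrow> ('l, 'm) triplet set" where
  "LMB_class T = LMB_rel `` {T}"

definition Obj_A :: "('l, 'm) triplet set set" where
  "Obj_A = LMB // LMB_rel"

definition common_lqg :: "('l, 'm) triplet set \<Rightarrow> 'l binary_system" where
  "common_lqg V = (THE L. \<forall>(L', M, \<pi>)\<in>V. L' = L)"

definition Obj_A2 :: "('l, 'm) triplet set set" where
  "Obj_A2 = {V \<in> Obj_A. \<exists>(L, M, \<pi>)\<in>V.
     (let \<mu> = (\<lambda>a b c. top3 M (a, b, c)) in
       \<forall>a\<in>tcarrier M. \<forall>b\<in>tcarrier M. \<forall>c\<in>tcarrier M. \<forall>d\<in>tcarrier M.
         \<mu> (\<mu> a b c) c d = \<mu> a b d \<and> \<mu> a b b = a)}"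

definition mu2 :: "'a binary_system \<Rightarrow> 'a \<times> 'a \<times> 'a \<Rightarrow> 'a" where
  "mu2 G = (\<lambda>(a, b, c)\<in>bcarrier G \<times> bcarrier G \<times> bcarrier G. bop G (c, ldiv G b a))"

lemma equiv_LMB_rel:
  "equiv LMB (LMB_rel :: (('l, 'm) triplet \<times> ('l, 'm) triplet) set)"
proof (rule equivI)
  show "LMB_rel \<subseteq> LMB \<times> LMB"
    by (auto simp: LMB_rel_def)
next
  show "refl_on LMB LMB_rel"
    by (rule refl_onI)
      (auto simp: LMB_rel_def LMB_def ternary_hom_def is_ternary_system_def
        bij_betw_inv_into_right PiE_iff)
next
  show "sym (LMB_rel :: (('l, 'm) triplet \<times> ('l, 'm) triplet) set)"
  proof (rule symI)
    fix x y :: "('l, 'm) triplet"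
    assume xy: "(x, y) \<in> LMB_rel"
    obtain L M \<pi> L' M' \<pi>' where x: "x = (L, M, \<pi>)" and y: "y = (L', M', \<pi>')"
      by (metis surj_pair)
    from xy x y have "((L, M, \<pi>), (L', M', \<pi>')) \<in> LMB_rel" by simp
    then have T: "(L, M, \<pi>) \<in> LMB" "(L, M', \<pi>') \<in> LMB" and eq: "L' = L"
      and hom: "ternary_hom M M' (\<pi>' \<circ> inv_into (bcarrier L) \<pi>)"
      by (auto simp: LMB_rel_def)
    let ?h = "\<pi>' \<circ> inv_into (bcarrier L) \<pi>" and ?k = "\<pi> \<circ> inv_into (bcarrier L) \<pi>'"
    have b: "bij_betw \<pi> (bcarrier L) (tcarrier M)" "bij_betw \<pi>' (bcarrier L) (tcarrier M')"
      and cl: "\<And>a b c. \<lbrakk>a \<in> tcarrier M; b \<in> tcarrier M; c \<in> tcarrier M\<rbrakk>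
        \<Longrightarrow> top3 M (a, b, c) \<in> tcarrier M"
      using T by (auto simp: LMB_def is_ternary_system_def)
    have kin: "?k x \<in> tcarrier M" if "x \<in> tcarrier M'" for x
      using that b by (metis bij_betw_apply bij_betw_inv_into comp_apply)
    have hk: "?h (?k x) = x" if "x \<in> tcarrier M'" for x
      using that b
      by (metis bij_betw_apply bij_betw_inv_into bij_betw_inv_into_left bij_betw_inv_into_right
          comp_apply)
    have kh: "?k (?h x) = x" if "x \<in> tcarrier M" for x
      using that b
      by (metis bij_betw_apply bij_betw_inv_into bij_betw_inv_into_left bij_betw_inv_into_right
          comp_apply)
    have "?k (top3 M' (a, b, c)) = top3 M (?k a, ?k b, ?k c)"
      if "a \<in> tcarrier M'" "b \<in> tcarrier M'" "c \<in> tcarrier M'" for a b c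
    proof -
      have "?h (top3 M (?k a, ?k b, ?k c)) = top3 M' (?h (?k a), ?h (?k b), ?h (?k c))"
        using hom kin that unfolding ternary_hom_def by blast
      then show ?thesis
        using that by (metis hk kh cl kin)
    qed
    then have "ternary_hom M' M ?k"
      using kin unfolding ternary_hom_def by blast
    then show "(y, x) \<in> LMB_rel"
      using T eq x y by (simp add: LMB_rel_def)
  qed
next
  show "trans (LMB_rel :: (('l, 'm) triplet \<times> ('l, 'm) triplet) set)"
  proof (rule transI)
    fix x y z :: "('l, 'm) triplet"
    assume xyz: "(x, y) \<in> LMB_rel" "(y, z) \<in> LMB_rel"
    obtain L M \<pi> L' M' \<pi>' L'' M'' \<pi>''
      where t: "x = (L, M, \<pi>)" "y = (L', M', \<pi>')" "z = (L'', M'', \<pi>'')"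
      by (metis surj_pair)
    from xyz t have r: "((L, M, \<pi>), (L', M', \<pi>')) \<in> LMB_rel"
      "((L', M', \<pi>'), (L'', M'', \<pi>'')) \<in> LMB_rel" by simp_all
    let ?h = "\<pi>' \<circ> inv_into (bcarrier L) \<pi>" and ?k = "\<pi>'' \<circ> inv_into (bcarrier L) \<pi>'"
    have b: "bij_betw \<pi> (bcarrier L) (tcarrier M)" "bij_betw \<pi>' (bcarrier L) (tcarrier M')"
      and cl: "\<And>a b c. \<lbrakk>a \<in> tcarrier M; b \<in> tcarrier M; c \<in> tcarrier M\<rbrakk>
        \<Longrightarrow> top3 M (a, b, c) \<in> tcarrier M"
      and eq: "L' = L" "L'' = L"
      and hom: "ternary_hom M M' ?h" "ternary_hom M' M'' ?k"
      using r by (auto simp: LMB_rel_def LMB_def is_ternary_system_def)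
    have comp: "(\<pi>'' \<circ> inv_into (bcarrier L) \<pi>) x = ?k (?h x)" if "x \<in> tcarrier M" for x
      using that b
      by (metis bij_betw_apply bij_betw_inv_into bij_betw_inv_into_left comp_apply)
    have hin: "?h x \<in> tcarrier M'" if "x \<in> tcarrier M" for x
      using hom(1) that unfolding ternary_hom_def by blast
    have "ternary_hom M M'' (\<pi>'' \<circ> inv_into (bcarrier L) \<pi>)"
      unfolding ternary_hom_def
    proof (intro conjI ballI)
      show "\<pi>'' \<circ> inv_into (bcarrier L) \<pi> \<in> tcarrier M \<rightarrow> tcarrier M''"
        using hom(2) hin comp unfolding ternary_hom_def by (metis PiE Pi_I)
    next
      fix a b c
      assume abc: "a \<in> tcarrier M" "b \<in> tcarrier M" "c \<in> tcarrier M"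
      have "?h (top3 M (a, b, c)) = top3 M' (?h a, ?h b, ?h c)"
        using hom(1) abc unfolding ternary_hom_def by blast
      moreover have "?k (top3 M' (?h a, ?h b, ?h c)) = top3 M'' (?k (?h a), ?k (?h b), ?k (?h c))"
        using hom(2) abc hin unfolding ternary_hom_def by blast
      ultimately show "(\<pi>'' \<circ> inv_into (bcarrier L) \<pi>) (top3 M (a, b, c)) =
          top3 M'' ((\<pi>'' \<circ> inv_into (bcarrier L) \<pi>) a, (\<pi>'' \<circ> inv_into (bcarrier L) \<pi>) b,
            (\<pi>'' \<circ> inv_into (bcarrier L) \<pi>) c)"
        using abc cl comp by metis
    qed
    then show "(x, z) \<in> LMB_rel"
      using r eq t by (simp add: LMB_rel_def)
  qed
qed

lemma common_lqg_eq:
  assumes "V \<in> Obj_A" and "(L, M, \<pi>) \<in> V"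
  shows "common_lqg V = L"
proof -
  have "\<forall>(L', M', \<pi>')\<in>V. L' = L"
    using assms by (auto simp: Obj_A_def quotient_def LMB_rel_def)
  then show ?thesis
    unfolding common_lqg_def using assms(2) by (intro the_equality) auto
qed

end

theory Submission
  imports Defs
begin

text \<open>
  For \<open>b, c \<in> M\<close> let \<open>T\<^sub>b\<^sub>c\<close> be the map \<open>a \<mapsto> \<mu>(a, b, c)\<close>. The two identities defining \<open>\<A>\<^sub>2\<close> say that
  \<open>T\<^sub>c\<^sub>d \<circ> T\<^sub>b\<^sub>c = T\<^sub>b\<^sub>d\<close> and \<open>T\<^sub>b\<^sub>b = id\<close>. Such a family of maps is determined by those that start at a
  single base point \<open>e\<close>, because \<open>T\<^sub>b\<^sub>c = T\<^sub>e\<^sub>c \<circ> T\<^sub>e\<^sub>b\<inverse>\<close>; moreover every \<open>T\<^sub>e\<^sub>c\<close> is a bijection,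
  with inverse \<open>T\<^sub>c\<^sub>e\<close>.

  Hence let \<open>G\<close> be the set \<open>M\<close> itself, with \<open>T\<^sub>e\<^sub>c\<close> as the left multiplication by \<open>c\<close>. This is a
  left quasigroup whose left division by \<open>b\<close> is \<open>T\<^sub>b\<^sub>e\<close>, and \<open>c * (b \ a) = T\<^sub>e\<^sub>c (T\<^sub>b\<^sub>e a) = \<mu>(a, b, c)\<close>.
  So the ternary system built from \<open>G\<close> is \<open>M\<close> on the nose, and the bijection of any suitable
  representative can be kept unchanged.

  The identity required of \<open>G\<close> is the first defining identity of \<open>LMB\<close> in other coordinates. By
  the composition law the latter reads \<open>\<mu>(a, \<mu>(a, b, c), \<mu>(a, b, d)) = \<mu>(a, b, \<mu>(b, c, d))\<close>.
  Every pair \<open>a, b\<close> has the form \<open>b = c * y\<close>, \<open>a = b * x\<close>, and then this becomes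
  \<open>(d * x) * ((c * x) \ ((c * y) * x)) = (d * y) * x\<close>, so that dividing by \<open>d * x\<close> gives the
  independence of \<open>(c * x) \ ((c * y) * x)\<close> from \<open>c\<close>.
\<close>

locale transport_system =
  fixes M :: "'m ternary_system"
  assumes ternary: "is_ternary_system M"
    and compose: "\<lbrakk>a \<in> tcarrier M; b \<in> tcarrier M; c \<in> tcarrier M; d \<in> tcarrier M\<rbrakk>
      \<Longrightarrow> top3 M (top3 M (a, b, c), c, d) = top3 M (a, b, d)"
    and unit: "\<lbrakk>a \<in> tcarrier M; b \<in> tcarrier M\<rbrakk> \<Longrightarrow> top3 M (a, b, b) = a"
begin

lemma closed:
  "\<lbrakk>a \<in> tcarrier M; b \<in> tcarrier M; c \<in> tcarrier M\<rbrakk> \<Longrightarrow> top3 M (a, b, c) \<in> tcarrier M"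
  using ternary by (auto simp: is_ternary_system_def)

definition based_lqg :: "'m \<Rightarrow> 'm binary_system" where
  "based_lqg e = \<lparr>bcarrier = tcarrier M,
     bop = (\<lambda>(c, v)\<in>tcarrier M \<times> tcarrier M. top3 M (v, e, c))\<rparr>"

lemma bcarrier_based_lqg [simp]: "bcarrier (based_lqg e) = tcarrier M"
  by (simp add: based_lqg_def)

lemma bop_based_lqg:
  "\<lbrakk>c \<in> tcarrier M; v \<in> tcarrier M\<rbrakk> \<Longrightarrow> bop (based_lqg e) (c, v) = top3 M (v, e, c)"
  by (simp add: based_lqg_def)

text \<open>
  Since transport from \<open>e\<close> to \<open>u\<close> is inverted by transport from \<open>u\<close> back to \<open>e\<close>, equations in
  \<open>G\<close> can be solved explicitly.
\<close>

lemma bop_based_lqg_eq_iff: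
  assumes "e \<in> tcarrier M" "u \<in> tcarrier M" "w \<in> tcarrier M"
  shows "v \<in> tcarrier M \<and> bop (based_lqg e) (u, v) = w \<longleftrightarrow> v = top3 M (w, u, e)"
  using assms by (auto simp: bop_based_lqg compose unit closed)

lemma ldiv_based_lqg:
  assumes "e \<in> tcarrier M" "u \<in> tcarrier M" "w \<in> tcarrier M"
  shows "ldiv (based_lqg e) u w = top3 M (w, u, e)"
  using bop_based_lqg_eq_iff[OF assms] by (simp add: ldiv_def)

lemma left_quasigroup_based_lqg:
  assumes "e \<in> tcarrier M"
  shows "left_quasigroup (based_lqg e)"
proof -
  have "bop (based_lqg e) \<in> tcarrier M \<times> tcarrier M \<rightarrow>\<^sub>E tcarrier M"
    using assms by (auto simp: based_lqg_def closed)
  then show ?thesis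
    using assms by (auto simp: left_quasigroup_def bop_based_lqg_eq_iff)
qed

text \<open>
  Transport from \<open>b\<close> to \<open>c\<close> factors through the base point. Both operations are undefined outside
  the carrier, so that the equality holds between the functions themselves.
\<close>

lemma mu2_based_lqg:
  assumes "e \<in> tcarrier M"
  shows "mu2 (based_lqg e) = top3 M"
proof
  fix t :: "'m \<times> 'm \<times> 'm"
  obtain a b c where t: "t = (a, b, c)" by (cases t)
  show "mu2 (based_lqg e) t = top3 M t"
  proof (cases "t \<in> tcarrier M \<times> tcarrier M \<times> tcarrier M")
    case True
    with assms t show ?thesis
      by (simp add: mu2_def ldiv_based_lqg bop_based_lqg closed compose)
  next
    case False
    with ternary have "top3 M t = undefined"
      unfolding is_ternary_system_def by (blast intro: PiE_arb)
    with False show ?thesis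
      by (simp add: mu2_def)
  qed
qed

text \<open>
  The hypothesis is the first identity of \<open>LMB\<close>, whose inner term has been simplified by the
  composition law. In it \<open>d\<close> enters the left-hand side only as the endpoint of a transport, so
  transporting back from there leaves an expression in \<open>c\<close> alone.
\<close>

lemma based_lqg_ldiv_independent:
  assumes braid: "\<And>a b c d. \<lbrakk>a \<in> tcarrier M; b \<in> tcarrier M; c \<in> tcarrier M; d \<in> tcarrier M\<rbrakk>
      \<Longrightarrow> top3 M (a, top3 M (a, b, c), top3 M (a, b, d)) = top3 M (a, b, top3 M (b, c, d))"
    and e: "e \<in> tcarrier M"
    and x: "x \<in> tcarrier M" and y: "y \<in> tcarrier M" and c: "c \<in> tcarrier M" and d: "d \<in> tcarrier M"
  defines "G \<equiv> based_lqg e"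
  shows "ldiv G (bop G (d, x)) (bop G (bop G (d, y), x)) =
    ldiv G (bop G (c, x)) (bop G (bop G (c, y), x))"
proof -
  \<comment> \<open>In terms of \<open>G\<close>: \<open>b = c * y\<close> and \<open>a = (c * y) * x\<close>, so that \<open>b\<close> cancels on both sides of \<open>braid\<close>.\<close>
  define b where "b = top3 M (y, e, c)"
  define a where "a = top3 M (x, e, b)"
  note mem = e x y c d
  have b: "b \<in> tcarrier M" using mem by (simp add: b_def closed)
  have a: "a \<in> tcarrier M" using mem b by (simp add: a_def closed)
  have dy: "top3 M (b, c, d) = top3 M (y, e, d)"
    using mem by (simp add: b_def compose)
  have from_b: "top3 M (a, b, z) = top3 M (x, e, z)" if "z \<in> tcarrier M" for z
    using mem b that by (simp add: a_def compose)
  have "top3 M (x, e, top3 M (y, e, d)) = top3 M (a, top3 M (x, e, c), top3 M (x, e, d))"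
    using braid[OF a b c d] mem by (simp add: dy from_b closed)
  \<comment> \<open>Transport from \<open>d * x\<close> back to \<open>e\<close> is left division by \<open>d * x\<close>; it removes \<open>d\<close> from the right-hand side.\<close>
  then have "top3 M (top3 M (x, e, top3 M (y, e, d)), top3 M (x, e, d), e) =
      top3 M (a, top3 M (x, e, c), e)"
    using mem a by (simp add: compose closed)
  then show ?thesis
    using mem by (simp add: G_def bop_based_lqg ldiv_based_lqg closed a_def b_def)
qed

end

theorem proposition6p17:
  fixes V :: "('l, 'm) triplet set"
  assumes "V \<in> Obj_A2"
  shows "\<exists>(G :: 'm binary_system) (\<pi>' :: 'l \<Rightarrow> 'm).
    left_quasigroup G \<and>
    (\<forall>a\<in>bcarrier G. \<forall>a'\<in>bcarrier G. \<forall>b\<in>bcarrier G. \<forall>c\<in>bcarrier G.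
       ldiv G (bop G (a, c)) (bop G (bop G (a, b), c)) =
       ldiv G (bop G (a', c)) (bop G (bop G (a', b), c))) \<and>
    \<pi>' \<in> extensional (bcarrier (common_lqg V)) \<and>
    bij_betw \<pi>' (bcarrier (common_lqg V)) (bcarrier G) \<and>
    V = LMB_class (common_lqg V, \<lparr>tcarrier = bcarrier G, top3 = mu2 G\<rparr>, \<pi>')"
proof -
  from assms obtain L M \<pi> where obj: "V \<in> Obj_A" and rep: "(L, M, \<pi>) \<in> V"
    and A2: "\<And>a b c d. \<lbrakk>a \<in> tcarrier M; b \<in> tcarrier M; c \<in> tcarrier M; d \<in> tcarrier M\<rbrakk>
      \<Longrightarrow> top3 M (top3 M (a, b, c), c, d) = top3 M (a, b, d) \<and> top3 M (a, b, b) = a"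
    unfolding Obj_A2_def Let_def by auto
  have L: "common_lqg V = L"
    using obj rep by (rule common_lqg_eq)
  have lmb: "(L, M, \<pi>) \<in> LMB"
    using obj rep in_quotient_imp_subset[OF equiv_LMB_rel] unfolding Obj_A_def by blast
  then have ternary: "is_ternary_system M" and \<pi>: "\<pi> \<in> extensional (bcarrier L)"
    "bij_betw \<pi> (bcarrier L) (tcarrier M)"
    by (simp_all add: LMB_def)
  interpret transport_system M
    using ternary A2 by unfold_locales blast+
  have braid: "top3 M (a, top3 M (a, b, c), top3 M (a, b, d)) = top3 M (a, b, top3 M (b, c, d))"
    if "a \<in> tcarrier M" "b \<in> tcarrier M" "c \<in> tcarrier M" "d \<in> tcarrier M" for a b c d
  proof -
    have "top3 M (a, top3 M (a, b, c), top3 M (top3 M (a, b, c), c, d)) =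
        top3 M (a, b, top3 M (b, c, d))"
      using lmb that unfolding LMB_def Let_def by blast
    then show ?thesis
      using that by (simp add: compose)
  qed
  obtain e where e: "e \<in> tcarrier M"
    using ternary unfolding is_ternary_system_def by blast
  have M: "\<lparr>tcarrier = bcarrier (based_lqg e), top3 = mu2 (based_lqg e)\<rparr> = M"
    using e by (simp add: mu2_based_lqg)
  have "V = LMB_class (L, M, \<pi>)"
  proof -
    obtain T where V: "V = LMB_rel `` {T}"
      using obj unfolding Obj_A_def by (rule quotientE)
    with rep have "(T, (L, M, \<pi>)) \<in> LMB_rel" by simp
    then show ?thesis
      unfolding V LMB_class_def by (rule equiv_class_eq[OF equiv_LMB_rel])
  qed
  then have V: "V = LMB_class (common_lqg V,
      \<lparr>tcarrier = bcarrier (based_lqg e), top3 = mu2 (based_lqg e)\<rparr>, \<pi>)"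
    unfolding L M .
  show ?thesis
  proof (rule exI[of _ "based_lqg e"], rule exI[of _ \<pi>], intro conjI ballI)
    show "left_quasigroup (based_lqg e)"
      using e by (rule left_quasigroup_based_lqg)
    show "ldiv (based_lqg e) (bop (based_lqg e) (a, c))
          (bop (based_lqg e) (bop (based_lqg e) (a, b), c)) =
        ldiv (based_lqg e) (bop (based_lqg e) (a', c))
          (bop (based_lqg e) (bop (based_lqg e) (a', b), c))"
      if "a \<in> bcarrier (based_lqg e)" "a' \<in> bcarrier (based_lqg e)"
        "b \<in> bcarrier (based_lqg e)" "c \<in> bcarrier (based_lqg e)" for a a' b c
      using that by (intro based_lqg_ldiv_independent braid e) simp_all
    show "V = LMB_class (common_lqg V,
        \<lparr>tcarrier = bcarrier (based_lqg e), top3 = mu2 (based_lqg e)\<rparr>, \<pi>)"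
      by (rule V)
  qed (simp_all add: L \<pi>)
qed

end
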